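(* Let $\mathcal A$ be a unital complex $C^*$-algebra, let $a\in\mathcal A$, and let $\mathcal B$ be a (complex linear) subspace of $\mathcal A$. Let $b_0\in\mathcal B$ be a best approximation to $a$ in $\mathcal B$, i.e. $\|a-b_0\|\le\|a-b\|$ for all $b\in\mathcal B$. For a state $\phi$ on $\mathcal A$, let $\mathcal L_\phi=\{c\in\mathcal A:\phi(c^*c)=0\}$, equip $\mathcal A/\mathcal L_\phi$ with the inner product $\langle a_1+\mathcal L_\phi\,|\,a_2+\mathcal L_\phi\rangle=\phi(a_1^*a_2)$, let $\mathcal B/\mathcal L_\phi=\{b+\mathcal L_\phi: b\in\mathcal B\}\subseteq \mathcal A/\mathcal L_\phi$, and define $$M_{a,\mathcal B}(\phi)=\sup\Big\{\phi\big((a-b_0)^*(a-b_0)\big)-\sum_{\alpha}\big|\phi\big((a-b_0)^*b_\alpha\big)\big|^2\Big\},$$ where the supremum is taken over all orthonormal bases $\{b_\alpha+\mathcal L_\phi\}$ (with $b_\alpha\in\mathcal B$) of $\mathcal B/\mathcal L_\phi$ in the inner product space $\mathcal A/\mathcal L_\phi$. Then $$\operatorname{dist}(a,\mathcal B)^2=\max\{M_{a,\mathcal B}(\phi):\phi\in S_{\mathcal A}\},$$ where $\operatorname{dist}(a,\mathcal B)=\inf\{\|a-b\|:b\in\mathcal B\}$ and $S_{\mathcal A}$ is the set of states on $\mathcal A$.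
   Context: A state on a unital complex $C^*$-algebra $\mathcal A$ with identity $1_{\mathcal A}$ is a linear functional $\phi$ on $\mathcal A$ with $\phi(1_{\mathcal A})=1$ and $\phi(c)\ge 0$ for every positive element $c\in\mathcal A$. $S_{\mathcal A}$ denotes the set of all states on $\mathcal A$. *)

theory Defs
  imports "HOL-Analysis.Analysis"
begin

locale cstar_algebra =
  fixes scaleC :: "complex \<Rightarrow> 'a::{real_normed_algebra_1,banach} \<Rightarrow> 'a"
    and star :: "'a \<Rightarrow> 'a"
  assumes scaleC_add_right: "scaleC c (x + y) = scaleC c x + scaleC c y"
    and scaleC_add_left: "scaleC (c + d) x = scaleC c x + scaleC d x"
    and scaleC_scaleC: "scaleC c (scaleC d x) = scaleC (c * d) x"
    and scaleC_one: "scaleC 1 x = x"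
    and scaleC_of_real: "scaleC (complex_of_real r) x = r *\<^sub>R x"
    and mult_scaleC_left: "scaleC c x * y = scaleC c (x * y)"
    and mult_scaleC_right: "x * scaleC c y = scaleC c (x * y)"
    and norm_scaleC: "norm (scaleC c x) = cmod c * norm x"
    and star_star: "star (star x) = x"
    and star_add: "star (x + y) = star x + star y"
    and star_scaleC: "star (scaleC c x) = scaleC (cnj c) (star x)"
    and star_mult: "star (x * y) = star y * star x"
    and cstar_identity: "norm (star x * x) = (norm x)\<^sup>2"

definition cinvertible :: "'a::ring_1 \<Rightarrow> bool" where
  "cinvertible x \<longleftrightarrow> (\<exists>y. x * y = 1 \<and> y * x = 1)"

definition cspectrum :: "(complex \<Rightarrow> 'a::ring_1 \<Rightarrow> 'a) \<Rightarrow> 'a \<Rightarrow> complex set" where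
  "cspectrum scaleC x = {z. \<not> cinvertible (x - scaleC z 1)}"

definition positive_elem :: "(complex \<Rightarrow> 'a::ring_1 \<Rightarrow> 'a) \<Rightarrow> ('a \<Rightarrow> 'a) \<Rightarrow> 'a \<Rightarrow> bool" where
  "positive_elem scaleC star c \<longleftrightarrow>
     star c = c \<and> cspectrum scaleC c \<subseteq> {z. Im z = 0 \<and> Re z \<ge> 0}"

definition is_state :: "(complex \<Rightarrow> 'a::ring_1 \<Rightarrow> 'a) \<Rightarrow> ('a \<Rightarrow> 'a) \<Rightarrow> ('a \<Rightarrow> complex) \<Rightarrow> bool" where
  "is_state scaleC star \<phi> \<longleftrightarrow>
     (\<forall>x y. \<phi> (x + y) = \<phi> x + \<phi> y) \<and> (\<forall>c x. \<phi> (scaleC c x) = c * \<phi> x) \<and>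
     \<phi> 1 = 1 \<and>
     (\<forall>c. positive_elem scaleC star c \<longrightarrow> Im (\<phi> c) = 0 \<and> Re (\<phi> c) \<ge> 0)"

definition states :: "(complex \<Rightarrow> 'a::ring_1 \<Rightarrow> 'a) \<Rightarrow> ('a \<Rightarrow> 'a) \<Rightarrow> ('a \<Rightarrow> complex) set" where
  "states scaleC star = {\<phi>. is_state scaleC star \<phi>}"

definition complex_subspace :: "(complex \<Rightarrow> 'a::ring_1 \<Rightarrow> 'a) \<Rightarrow> 'a set \<Rightarrow> bool" where
  "complex_subspace scaleC B \<longleftrightarrow>
     0 \<in> B \<and> (\<forall>x\<in>B. \<forall>y\<in>B. x + y \<in> B) \<and> (\<forall>c. \<forall>x\<in>B. scaleC c x \<in> B)"

text \<open>S is a set of representatives (in B) of an orthonormal basis (maximal orthonormal set)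
  of B/L_phi in the inner product space A/L_phi, with inner product phi(star a1 * a2).
  Maximality: no coset b + L_phi (b in B) of norm 1 orthogonal to all elements of the family.\<close>
definition quot_onb :: "('a::ring_1 \<Rightarrow> 'a) \<Rightarrow> ('a \<Rightarrow> complex) \<Rightarrow> 'a set \<Rightarrow> 'a set \<Rightarrow> bool" where
  "quot_onb star \<phi> B S \<longleftrightarrow>
     S \<subseteq> B \<and>
     (\<forall>x\<in>S. \<phi> (star x * x) = 1) \<and>
     (\<forall>x\<in>S. \<forall>y\<in>S. x \<noteq> y \<longrightarrow> \<phi> (star x * y) = 0) \<and>
     \<not> (\<exists>b\<in>B. \<phi> (star b * b) = 1 \<and> (\<forall>x\<in>S. \<phi> (star x * b) = 0))"

definition M_aB :: "('a::ring_1 \<Rightarrow> 'a) \<Rightarrow> 'a \<Rightarrow> 'a set \<Rightarrow> 'a \<Rightarrow> ('a \<Rightarrow> complex) \<Rightarrow> real" where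
  "M_aB star a B b0 \<phi> =
     Sup {Re (\<phi> (star (a - b0) * (a - b0)))
            - (\<Sum>\<^sub>\<infinity>x\<in>S. (cmod (\<phi> (star (a - b0) * x)))\<^sup>2) | S. quot_onb star \<phi> B S}"

definition dist_to :: "'a::real_normed_vector \<Rightarrow> 'a set \<Rightarrow> real" where
  "dist_to a B = Inf ((\<lambda>b. norm (a - b)) ` B)"

end

theory Submission
  imports Defs
begin

text \<open>
  Put \<open>c = a - b\<^sub>0\<close>. Every value in the supremum is at most \<open>\<phi> (c\<^sup>* c) \<le> \<parallel>c\<parallel>\<^sup>2\<close>, so it is enough to find a
  state with \<open>\<phi> (c\<^sup>* c) = \<parallel>c\<parallel>\<^sup>2\<close> that annihilates \<open>c\<^sup>* B\<close>.

  States are the complexifications of the real linear functionals dominated by the sublinear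
  functional \<open>p = numax\<close>, \<open>p x = inf\<^sub>t (\<parallel>t + x\<parallel> - t)\<close>, which on self-adjoint elements is the maximum of the
  spectrum. Since \<open>p (x\<^sup>* x) = \<parallel>x\<parallel>\<^sup>2\<close>, expanding \<open>\<parallel>c + t b\<parallel>\<^sup>2 \<ge> \<parallel>c\<parallel>\<^sup>2\<close> for small \<open>t\<close> gives
  \<open>\<parallel>c\<parallel>\<^sup>2 \<le> p (c\<^sup>* c + c\<^sup>* b)\<close> for all \<open>b\<close> in \<open>B\<close>, and a Hahn-Banach argument produces the state.
\<close>

subsection \<open>Sublinear functionals and the Hahn-Banach theorem\<close>

definition sublinear :: "('a::real_vector \<Rightarrow> real) \<Rightarrow> bool" where
  "sublinear p \<longleftrightarrow>
     (\<forall>x y. p (x + y) \<le> p x + p y) \<and> (\<forall>t\<ge>0. \<forall>x. p (t *\<^sub>R x) = t * p x)"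

lemma sublinearI:
  assumes add: "\<And>x y. p (x + y) \<le> p x + p y"
    and zero: "p 0 = 0"
    and scale: "\<And>t x. t > 0 \<Longrightarrow> p (t *\<^sub>R x) \<le> t * p x"
  shows "sublinear p"
  unfolding sublinear_def
proof (intro conjI allI impI add)
  fix t :: real and x assume "0 \<le> t"
  show "p (t *\<^sub>R x) = t * p x"
  proof (cases "t = 0")
    case False
    with \<open>0 \<le> t\<close> have t: "t > 0" by simp
    have "p x \<le> (1 / t) * p (t *\<^sub>R x)"
      using scale[of "1 / t" "t *\<^sub>R x"] t by simp
    then have "t * p x \<le> p (t *\<^sub>R x)"
      using t by (simp add: field_simps)
    with scale[OF t, of x] show ?thesis by simp
  qed (simp add: zero)
qed

lemma sublinear_add: "sublinear p \<Longrightarrow> p (x + y) \<le> p x + p y"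
  and sublinear_scale: "sublinear p \<Longrightarrow> t \<ge> 0 \<Longrightarrow> p (t *\<^sub>R x) = t * p x"
  by (auto simp: sublinear_def)

lemma sublinear_zero: "sublinear p \<Longrightarrow> p 0 = 0"
  using sublinear_scale[of p 0 0] by simp

lemma sublinear_minus: "sublinear p \<Longrightarrow> - p (- x) \<le> p x"
  using sublinear_add[of p x "- x"] sublinear_zero[of p] by simp

text \<open>A pair (x, r) in \<open>C\<close> stands for the constraint r \<le> g x on a linear g.
  The functional \<open>q\<close> absorbs these constraints into the upper bound: a linear g below
  \<open>q\<close> has - g y = g (- y) \<le> q (- y) \<le> - r.\<close>

lemma sublinear_Inf_cone:
  fixes p :: "'a::real_vector \<Rightarrow> real" and C :: "('a \<times> real) set"
  assumes p: "sublinear p"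
    and C: "convex_cone C"
    and dom: "\<forall>(x, r)\<in>C. r \<le> p x"
  defines "q \<equiv> \<lambda>x. INF z\<in>C. p (x + fst z) - snd z"
  shows "sublinear q" "q x \<le> p x" "(y, r) \<in> C \<Longrightarrow> q (- y) \<le> - r"
proof -
  have ne: "C \<noteq> {}"
    using C by (rule convex_cone_nonempty)
  have add: "(x + y, r + s) \<in> C" if "(x, r) \<in> C" "(y, s) \<in> C" for x r y s
    using convex_cone_add[OF C that] by simp
  have scale: "(t *\<^sub>R x, t * r) \<in> C" if "t \<ge> 0" "(x, r) \<in> C" for t x r
    using convex_cone_scaleR[OF C that] by simp
  have bdd: "bdd_below ((\<lambda>z. p (x + fst z) - snd z) ` C)" for x
  proof (rule bdd_belowI2)
    fix z assume "z \<in> C"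
    then have "snd z \<le> p (fst z)" using dom by auto
    then show "- p (- x) \<le> p (x + fst z) - snd z"
      using sublinear_add[OF p, of "x + fst z" "- x"] by simp
  qed
  have le: "q x \<le> p (x + y) - r" if "(y, r) \<in> C" for x y r
    unfolding q_def using cINF_lower[OF bdd that] by simp
  have ge: "m \<le> q x" if "\<And>y r. (y, r) \<in> C \<Longrightarrow> m \<le> p (x + y) - r" for m x
    unfolding q_def by (rule cINF_greatest[OF ne]) (use that in auto)
  have 0: "(0, 0) \<in> C"
    using convex_cone_contains_0[OF C] by (simp add: zero_prod_def)
  show "q x \<le> p x" for x
    using le[OF 0, of x] by simp
  show "q (- y) \<le> - r" if "(y, r) \<in> C"
    using le[OF that, of "- y"] sublinear_zero[OF p] by simp
  show "sublinear q"
  proof (rule sublinearI)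
    show "q 0 = 0"
      using le[OF 0, of 0] ge[of 0 0] dom sublinear_zero[OF p] by fastforce
  next
    fix t :: real and x assume t: "t > 0"
    have "q (t *\<^sub>R x) / t \<le> q x"
    proof (rule ge)
      fix y r assume "(y, r) \<in> C"
      then have "q (t *\<^sub>R x) \<le> p (t *\<^sub>R (x + y)) - t * r"
        using le[OF scale, of t y r "t *\<^sub>R x"] t by (simp add: scaleR_add_right)
      also have "\<dots> = t * (p (x + y) - r)"
        using sublinear_scale[OF p, of t] t by (simp add: right_diff_distrib)
      finally show "q (t *\<^sub>R x) / t \<le> p (x + y) - r"
        using t by (simp add: field_simps)
    qed
    then show "q (t *\<^sub>R x) \<le> t * q x"
      using t by (simp add: field_simps)
  next
    fix x y
    have "q (x + y) - q x \<le> q y"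
    proof (rule ge)
      fix v s assume v: "(v, s) \<in> C"
      have "q (x + y) - (p (y + v) - s) \<le> q x"
      proof (rule ge)
        fix u r assume u: "(u, r) \<in> C"
        have "q (x + y) \<le> p ((x + u) + (y + v)) - (r + s)"
          using le[OF add[OF u v], of "x + y"] by (simp add: algebra_simps)
        also have "\<dots> \<le> p (x + u) + p (y + v) - (r + s)"
          using sublinear_add[OF p] by simp
        finally show "q (x + y) - (p (y + v) - s) \<le> p (x + u) - r" by simp
      qed
      then show "q (x + y) - q x \<le> p (y + v) - s" by simp
    qed
    then show "q (x + y) \<le> q x + q y" by simp
  qed
qed

text \<open>Lower bounds of chains for Zorn's lemma. The infimum is finite since f x \<ge> - f (- x)
  \<ge> - p (- x) for each member f. It is subadditive since f at x and g at y may both be replaced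
  by the smaller of f and g.\<close>

lemma sublinear_Inf_chain:
  assumes ne: "F \<noteq> {}"
    and sub: "\<And>f. f \<in> F \<Longrightarrow> sublinear f"
    and total: "\<And>f g. f \<in> F \<Longrightarrow> g \<in> F \<Longrightarrow> f \<le> g \<or> g \<le> f"
    and dom: "\<And>f. f \<in> F \<Longrightarrow> f \<le> p"
  defines "q \<equiv> \<lambda>x. INF f\<in>F. f x"
  shows "sublinear q" "f \<in> F \<Longrightarrow> q \<le> f"
proof -
  have bdd: "bdd_below ((\<lambda>f. f x) ` F)" for x
  proof (rule bdd_belowI2)
    fix f assume f: "f \<in> F"
    then show "- p (- x) \<le> f x"
      using sublinear_minus[OF sub[OF f], of x] dom[OF f] by (auto simp: le_fun_def intro: order_trans[rotated])
  qed
  have le: "q x \<le> f x" if "f \<in> F" for f x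
    unfolding q_def using cINF_lower[OF bdd that] by simp
  have ge: "m \<le> q x" if "\<And>f. f \<in> F \<Longrightarrow> m \<le> f x" for m x
    unfolding q_def by (rule cINF_greatest[OF ne]) (use that in auto)
  show "q \<le> f" if "f \<in> F"
    using le[OF that] by (simp add: le_fun_def)
  show "sublinear q"
  proof (rule sublinearI)
    have "f 0 = 0" if "f \<in> F" for f
      using sublinear_zero sub that by blast
    then have "q 0 = (INF f\<in>F. 0)"
      unfolding q_def by (rule INF_cong[OF refl])
    then show "q 0 = 0"
      using ne by simp
  next
    fix t :: real and x assume t: "t > 0"
    have "q (t *\<^sub>R x) / t \<le> q x"
    proof (rule ge)
      fix f assume f: "f \<in> F"
      show "q (t *\<^sub>R x) / t \<le> f x"
        using le[OF f, of "t *\<^sub>R x"] sublinear_scale[OF sub[OF f], of t x] t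
        by (simp add: field_simps)
    qed
    then show "q (t *\<^sub>R x) \<le> t * q x"
      using t by (simp add: field_simps)
  next
    fix x y
    have "q (x + y) - q x \<le> q y"
    proof (rule ge)
      fix g assume g: "g \<in> F"
      have "q (x + y) - g y \<le> q x"
      proof (rule ge)
        fix f assume f: "f \<in> F"
        obtain m where m: "m \<in> F" "m \<le> f" "m \<le> g"
          using total[OF f g] f g by blast
        have "q (x + y) \<le> m x + m y"
          using le[OF m(1), of "x + y"] sublinear_add[OF sub[OF m(1)], of x y] by simp
        then show "q (x + y) - g y \<le> f x"
          using le_funD[OF m(2), of x] le_funD[OF m(3), of y] by simp
      qed
      then show "q (x + y) - q x \<le> g y" by simp
    qed
    then show "q (x + y) \<le> q x + q y" by simp
  qed
qed

text \<open>Imposing g y \<ge> p y through the ray of (y, p y) yields a sublinear functional below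
  \<open>p\<close>, which minimality identifies with \<open>p\<close>. Hence p (- y) \<le> - p y, so
  p x \<le> p (x + y) - p y, the missing half of additivity.\<close>

lemma sublinear_minimal_linear:
  assumes p: "sublinear p"
    and min: "\<And>q. sublinear q \<Longrightarrow> q \<le> p \<Longrightarrow> q = p"
  shows "linear p"
proof -
  have add: "p (x + y) = p x + p y" for x y
  proof -
    let ?C = "(\<lambda>t. t *\<^sub>R (y, p y)) ` {0..}"
    let ?q = "\<lambda>x. INF z\<in>?C. p (x + fst z) - snd z"
    have C: "convex_cone ?C"
      unfolding convex_cone_iff
    proof (intro conjI ballI allI impI)
      show "0 \<in> ?C" by (rule image_eqI[of _ _ 0]) (auto simp: zero_prod_def)
    next
      fix u v assume "u \<in> ?C" "v \<in> ?C"
      then obtain a b where "a \<ge> 0" "b \<ge> 0" "u = a *\<^sub>R (y, p y)" "v = b *\<^sub>R (y, p y)"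
        by auto
      then show "u + v \<in> ?C"
        by (intro image_eqI[of _ _ "a + b"]) (auto simp: algebra_simps)
    next
      fix u and t :: real assume "u \<in> ?C" "t \<ge> 0"
      then show "t *\<^sub>R u \<in> ?C" by force
    qed
    have dom: "\<forall>(u, r)\<in>?C. r \<le> p u"
      using sublinear_scale[OF p] by auto
    note q = sublinear_Inf_cone[OF p C dom]
    have "?q = p"
      by (rule min[OF q(1) le_funI[OF q(2)]])
    moreover have y: "(y, p y) \<in> ?C" by (rule image_eqI[of _ _ 1]) auto
    ultimately have "p (- y) \<le> - p y"
      using q(3)[OF y] by (simp only: fun_eq_iff)
    then show ?thesis
      using sublinear_add[OF p, of "x + y" "- y"] sublinear_add[OF p, of x y] by simp
  qed
  show ?thesis
  proof (rule linearI[OF add])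
    fix t :: real and x
    have "p (- x) = - p x" for x
      using add[of x "- x"] sublinear_zero[OF p] by simp
    then show "p (t *\<^sub>R x) = t *\<^sub>R p x"
      using sublinear_scale[OF p, of t x] sublinear_scale[OF p, of "- t" "- x"]
      by (cases "t \<ge> 0") auto
  qed
qed

theorem sublinear_dominates_linear:
  fixes p :: "'a::real_vector \<Rightarrow> real"
  assumes p: "sublinear p"
  obtains g where "linear g" "g \<le> p"
proof -
  define Q where "Q = {q. sublinear q \<and> q \<le> p}"
  have "\<exists>m\<in>Q. \<forall>f\<in>Q. f \<le> m \<longrightarrow> f = m"
  proof (rule predicate_Zorn)
    \<comment> \<open>The order is reversed, so that Zorn's maximal element is a minimal sublinear
      functional.\<close>
    show "partial_order_on Q (relation_of (\<lambda>f g. g \<le> f) Q)"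
      by (rule partial_order_on_relation_ofI) auto
  next
    fix F assume F: "F \<in> Chains (relation_of (\<lambda>f g. g \<le> f) Q)"
    then have FQ: "F \<subseteq> Q" and total: "\<And>f g. f \<in> F \<Longrightarrow> g \<in> F \<Longrightarrow> f \<le> g \<or> g \<le> f"
      by (auto simp: Chains_def relation_of_def)
    show "\<exists>u\<in>Q. \<forall>f\<in>F. u \<le> f"
    proof (cases "F = {}")
      case True
      then show ?thesis using p by (auto simp: Q_def)
    next
      case False
      have sub: "\<And>f. f \<in> F \<Longrightarrow> sublinear f" and le: "\<And>f. f \<in> F \<Longrightarrow> f \<le> p"
        using FQ by (auto simp: Q_def)
      let ?q = "\<lambda>x. INF f\<in>F. f x"
      note q = sublinear_Inf_chain[OF False sub total le]
      obtain f where "f \<in> F" using False by blast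
      then have "?q \<le> p"
        using order_trans[OF q(2) le] by blast
      then have "?q \<in> Q"
        using q(1) by (simp add: Q_def)
      then show ?thesis
        using q(2) by blast
    qed
  qed
  then obtain m where m: "m \<in> Q" "\<And>f. f \<in> Q \<Longrightarrow> f \<le> m \<Longrightarrow> f = m"
    by blast
  show thesis
  proof
    show "linear m"
      by (rule sublinear_minimal_linear) (use m in \<open>auto simp: Q_def intro: order_trans\<close>)
    show "m \<le> p" using m by (simp add: Q_def)
  qed
qed

text \<open>Lower bounds on a cone prescribe values and annihilation at once: vanishing on a
  subspace amounts to the bound 0 at x and at - x.\<close>

theorem Hahn_Banach_cone:
  fixes p :: "'a::real_vector \<Rightarrow> real" and C :: "('a \<times> real) set"
  assumes p: "sublinear p"
    and C: "convex_cone C" "\<forall>(x, r)\<in>C. r \<le> p x"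
  obtains g where "linear g" "\<And>x. g x \<le> p x" "\<And>x r. (x, r) \<in> C \<Longrightarrow> r \<le> g x"
proof -
  let ?q = "\<lambda>x. INF z\<in>C. p (x + fst z) - snd z"
  note q = sublinear_Inf_cone[OF p C]
  obtain g where g: "linear g" "g \<le> ?q"
    using sublinear_dominates_linear[OF q(1)] by blast
  show thesis
  proof
    show "g x \<le> p x" for x
      using le_funD[OF g(2), of x] q(2)[of x] by simp
    show "r \<le> g x" if "(x, r) \<in> C" for x r
      using le_funD[OF g(2), of "- x"] q(3)[OF that] linear_neg[OF g(1), of x] by simp
  qed (rule g)
qed

subsection \<open>The numerical bound of a unital normed algebra\<close>

text \<open>With h = 1 / t this is the infimum of (norm (1 + h x) - 1) / h, the one-sided derivative
  of the norm at 1 in direction x. It equals the supremum of the real part of the numerical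
  range.\<close>

definition numax :: "'a::real_normed_algebra_1 \<Rightarrow> real" where
  "numax x = (INF t\<in>{0..}. norm (t *\<^sub>R 1 + x) - t)"

lemma numax_bdd: "bdd_below ((\<lambda>t. norm (t *\<^sub>R 1 + x) - t) ` {0..})"
  for x :: "'a::real_normed_algebra_1"
proof (rule bdd_belowI2)
  fix t :: real assume "t \<in> {0..}"
  then show "- norm x \<le> norm (t *\<^sub>R 1 + x) - t"
    using norm_triangle_ineq2[of "t *\<^sub>R (1::'a)" "- x"] by simp
qed

lemma numax_le: "t \<ge> 0 \<Longrightarrow> numax x \<le> norm (t *\<^sub>R 1 + x) - t"
  unfolding numax_def by (rule cINF_lower[OF numax_bdd]) simp

lemma numax_ge: "(\<And>t. t \<ge> 0 \<Longrightarrow> m \<le> norm (t *\<^sub>R 1 + x) - t) \<Longrightarrow> m \<le> numax x"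
  unfolding numax_def by (rule cINF_greatest) auto

lemma numax_lessE:
  assumes "numax x < m"
  obtains t where "t \<ge> 0" "norm (t *\<^sub>R 1 + x) - t < m"
  using assms numax_ge[of m x] that by fastforce

lemma numax_le_norm: "numax x \<le> norm x"
  using numax_le[of 0 x] by simp

lemma sublinear_numax: "sublinear (numax :: 'a::real_normed_algebra_1 \<Rightarrow> real)"
proof (rule sublinearI)
  show "numax (0::'a) = 0"
    using numax_le_norm[of "0::'a"] numax_ge[of 0 "0::'a"] by simp
next
  fix t :: real and x :: 'a assume t: "t > 0"
  have "numax (t *\<^sub>R x) / t \<le> numax x"
  proof (rule numax_ge)
    fix s :: real assume "s \<ge> 0"
    then have "numax (t *\<^sub>R x) \<le> norm (t *\<^sub>R (s *\<^sub>R 1 + x)) - t * s"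
      using numax_le[of "t * s" "t *\<^sub>R x"] t by (simp add: scaleR_add_right)
    also have "\<dots> = t * (norm (s *\<^sub>R 1 + x) - s)"
      using t by (simp add: right_diff_distrib)
    finally show "numax (t *\<^sub>R x) / t \<le> norm (s *\<^sub>R 1 + x) - s"
      using t by (simp add: field_simps)
  qed
  then show "numax (t *\<^sub>R x) \<le> t * numax x"
    using t by (simp add: field_simps)
next
  fix x y :: 'a
  have "numax (x + y) - numax x \<le> numax y"
  proof (rule numax_ge)
    fix s :: real assume s: "s \<ge> 0"
    have "numax (x + y) - (norm (s *\<^sub>R 1 + y) - s) \<le> numax x"
    proof (rule numax_ge)
      fix t :: real assume "t \<ge> 0"
      then have "numax (x + y) \<le> norm ((t *\<^sub>R 1 + x) + (s *\<^sub>R 1 + y)) - (t + s)"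
        using numax_le[of "t + s" "x + y"] s by (simp add: algebra_simps)
      then show "numax (x + y) - (norm (s *\<^sub>R 1 + y) - s) \<le> norm (t *\<^sub>R 1 + x) - t"
        using norm_triangle_ineq[of "t *\<^sub>R 1 + x" "s *\<^sub>R 1 + y"] by simp
    qed
    then show "numax (x + y) - numax x \<le> norm (s *\<^sub>R 1 + y) - s" by simp
  qed
  then show "numax (x + y) \<le> numax x + numax y" by simp
qed

lemmas numax_add = sublinear_add[OF sublinear_numax]
  and numax_scale = sublinear_scale[OF sublinear_numax]
  and numax_zero = sublinear_zero[OF sublinear_numax]
  and numax_minus = sublinear_minus[OF sublinear_numax]

lemma numax_of_real: "numax (t *\<^sub>R 1) = t"
proof -
  \<comment> \<open>For negative s the test point - s makes the norm vanish.\<close>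
  have "numax (s *\<^sub>R 1 :: 'a) \<le> s" for s
    using numax_le[of 0 "s *\<^sub>R (1::'a)"] numax_le[of "- s" "s *\<^sub>R (1::'a)"]
    by (cases "s \<ge> 0") auto
  from this[of t] this[of "- t"] show ?thesis
    using numax_minus[of "t *\<^sub>R (1::'a)"] by simp
qed

lemma numax_add_real: "numax (x + t *\<^sub>R 1) = numax x + t"
  using numax_add[of x "t *\<^sub>R 1"] numax_add[of "x + t *\<^sub>R 1" "(- t) *\<^sub>R 1"]
    numax_of_real[of t, where 'a='a] numax_of_real[of "- t", where 'a='a]
  by simp

lemma numax_diff_real: "numax (x - t *\<^sub>R 1) = numax x - t"
  using numax_add_real[of x "- t"] by simp

subsection \<open>Invertible elements of a unital Banach algebra\<close>

text \<open>Contractions take the place of the Neumann series: the fixed points of y \<mapsto> 1 + x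
  y and z \<mapsto> 1 + z x are a right and a left inverse, and associativity makes them
  equal.\<close>

lemma cinvertible_one_minus:
  fixes x :: "'a::{real_normed_algebra_1,banach}"
  assumes "norm x < 1"
  shows "cinvertible (1 - x)"
proof -
  have "\<exists>!y. 1 + x * y = y"
  proof (rule banach_fix_type)
    show "\<forall>y z. dist (1 + x * y) (1 + x * z) \<le> norm x * dist y z"
      using norm_mult_ineq[of x] by (simp add: dist_norm right_diff_distrib[symmetric])
  qed (use assms in auto)
  then obtain y where y: "1 + x * y = y" by blast
  have "\<exists>!y. 1 + y * x = y"
  proof (rule banach_fix_type)
    show "\<forall>y z. dist (1 + y * x) (1 + z * x) \<le> norm x * dist y z"
      using norm_mult_ineq[of _ x]
      by (simp add: dist_norm left_diff_distrib[symmetric] mult.commute[of "norm x"])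
  qed (use assms in auto)
  then obtain z where z: "1 + z * x = z" by blast
  have *: "(1 - x) * y = 1" "z * (1 - x) = 1"
    using y z by (simp_all add: algebra_simps)
  have "z = z * ((1 - x) * y)"
    by (simp only: *(1) mult_1_right)
  also have "\<dots> = y"
    by (simp only: *(2) mult_1_left mult.assoc[symmetric])
  finally show ?thesis
    using * unfolding cinvertible_def by blast
qed

lemma cinvertible_scaleR:
  fixes x :: "'a::real_algebra_1"
  assumes "cinvertible x" "t \<noteq> 0"
  shows "cinvertible (t *\<^sub>R x)"
proof -
  obtain y where "x * y = 1" "y * x = 1" using assms by (auto simp: cinvertible_def)
  then show ?thesis
    using assms(2) by (auto simp: cinvertible_def intro!: exI[of _ "(1 / t) *\<^sub>R y"])
qed

lemma cinvertible_of_norm_less: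
  fixes x :: "'a::{real_normed_algebra_1,banach}"
  assumes "norm (t *\<^sub>R 1 - x) < t"
  shows "cinvertible x"
proof -
  have t: "t > 0" using assms norm_ge_zero[of "t *\<^sub>R 1 - x"] by linarith
  have "norm ((1 / t) *\<^sub>R (t *\<^sub>R 1 - x)) < 1"
    using assms t by simp
  from cinvertible_scaleR[OF cinvertible_one_minus[OF this], of t] t show ?thesis
    by (simp add: scaleR_diff_right)
qed

text \<open>A negative value provides t with norm (t - x) < t, so x / t lies in the open unit ball
  around 1.\<close>

lemma numax_neg_cinvertible:
  fixes x :: "'a::{real_normed_algebra_1,banach}"
  assumes "numax (- x) < 0"
  shows "cinvertible x"
proof -
  obtain t where "norm (t *\<^sub>R 1 - x) < t"
    using numax_lessE[OF assms] by auto
  then show ?thesis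
    by (rule cinvertible_of_norm_less)
qed

lemma cinvertible_commuting_factor:
  fixes x y :: "'a::ring_1"
  assumes inv: "cinvertible (x * y)" and comm: "x * y = y * x"
  shows "cinvertible x"
proof -
  obtain z where z: "x * y * z = 1" "z * (x * y) = 1"
    using inv by (auto simp: cinvertible_def)
  have 1: "x * (y * z) = 1" using z by (simp add: mult.assoc)
  have 2: "(z * y) * x = 1" using z comm by (simp add: mult.assoc)
  have "z * y = (z * y) * (x * (y * z))" by (simp only: 1 mult_1_right)
  also have "\<dots> = (z * y) * x * (y * z)" by (simp only: mult.assoc)
  also have "\<dots> = y * z" by (simp only: 2 mult_1_left)
  finally show ?thesis using 1 2 by (auto simp: cinvertible_def)
qed

lemma inverse_commutes:
  fixes x y z :: "'a::ring_1"
  assumes "x * y = 1" "y * x = 1" "z * x = x * z"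
  shows "z * y = y * z"
proof -
  have "z * y = (y * x) * z * y" by (simp add: assms(2))
  also have "\<dots> = y * (x * z) * y" by (simp only: mult.assoc)
  also have "\<dots> = y * (z * x) * y" by (simp only: assms(3))
  also have "\<dots> = y * z * (x * y)" by (simp only: mult.assoc)
  finally show ?thesis by (simp add: assms(1))
qed

text \<open>Jacobson's lemma: if z inverts t - x y, then (1 + y z x) / t inverts t - y x.\<close>

lemma cinvertible_diff_mult_swap:
  fixes x y :: "'a::real_algebra_1"
  assumes inv: "cinvertible (t *\<^sub>R 1 - x * y)" and t: "t \<noteq> 0"
  shows "cinvertible (t *\<^sub>R 1 - y * x)"
proof -
  obtain z where "(t *\<^sub>R 1 - x * y) * z = 1" "z * (t *\<^sub>R 1 - x * y) = 1"
    using inv by (auto simp: cinvertible_def)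
  then have z: "t *\<^sub>R z = 1 + x * y * z" "t *\<^sub>R z = 1 + z * x * y"
    by (simp_all add: algebra_simps)
  have "y * (t *\<^sub>R z) * x = y * x + y * x * y * z * x" "y * (t *\<^sub>R z) * x = y * x + y * z * x * y * x"
    using arg_cong[OF z(1), of "\<lambda>u. y * u * x"] arg_cong[OF z(2), of "\<lambda>u. y * u * x"]
    by (simp_all only: distrib_left distrib_right mult_1_right mult.assoc)
  then have "(t *\<^sub>R 1 - y * x) * (1 + y * z * x) = t *\<^sub>R 1" "(1 + y * z * x) * (t *\<^sub>R 1 - y * x) = t *\<^sub>R 1"
    by (simp_all add: algebra_simps)
  then show ?thesis
    using t by (auto simp: cinvertible_def intro!: exI[of _ "(1 / t) *\<^sub>R (1 + y * z * x)"])
qed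

subsection \<open>Square roots and spectra of self-adjoint elements\<close>

context cstar_algebra
begin

lemma scaleC_scaleR: "scaleC c (r *\<^sub>R x) = r *\<^sub>R scaleC c x"
  by (simp add: scaleC_scaleC mult.commute flip: scaleC_of_real)

lemma scaleC_minus_right: "scaleC c (- x) = - scaleC c x"
  using scaleC_scaleR[of c "-1" x] by simp

lemma scaleC_diff_right: "scaleC c (x - y) = scaleC c x - scaleC c y"
  using scaleC_add_right[of c x "- y"] by (simp add: scaleC_minus_right)

lemma scaleC_minus_left: "scaleC (- c) x = - scaleC c x"
  using scaleC_scaleC[of "-1" c x] scaleC_of_real[of "-1" "scaleC c x"] by simp

lemma scaleC_i_i: "scaleC \<i> (scaleC \<i> x) = - x"
  using scaleC_of_real[of "-1" x] by (simp add: scaleC_scaleC)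

lemma star_scaleR: "star (r *\<^sub>R x) = r *\<^sub>R star x"
  by (simp add: star_scaleC flip: scaleC_of_real)

lemma star_minus: "star (- x) = - star x"
  using star_scaleR[of "-1" x] by simp

lemma star_diff: "star (x - y) = star x - star y"
  using star_add[of x "- y"] by (simp add: star_minus)

lemma star_zero: "star 0 = 0"
  using star_scaleR[of 0 0] by simp

lemma star_one: "star 1 = 1"
  using star_mult[of "star 1" 1] by (simp add: star_star)

lemma star_scaleC_i: "star (scaleC \<i> x) = - scaleC \<i> (star x)"
  by (simp add: star_scaleC scaleC_minus_left)

lemmas star_simps = star_star star_add star_diff star_minus star_zero star_one star_mult
  star_scaleR star_scaleC_i

lemma norm_star: "norm (star x) = norm x"
proof -
  have "norm x \<le> norm (star x)" for x
  proof (cases "x = 0")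
    case False
    have "norm x * norm x \<le> norm (star x) * norm x"
      using norm_mult_ineq[of "star x" x] cstar_identity[of x] by (simp add: power2_eq_square)
    then show ?thesis using False by simp
  qed simp
  from this[of x] this[of "star x"] show ?thesis by (simp add: star_star)
qed

lemma norm_square_selfadjoint: "star x = x \<Longrightarrow> norm (x * x) = (norm x)\<^sup>2"
  using cstar_identity[of x] by simp

lemma numax_star: "numax (star x) = numax x"
proof -
  have "norm (t *\<^sub>R 1 + star x) = norm (t *\<^sub>R 1 + x)" for t
    using norm_star[of "t *\<^sub>R 1 + x"] by (simp add: star_simps)
  then show ?thesis by (simp add: numax_def)
qed

lemma bounded_linear_star: "bounded_linear star"
  by (rule bounded_linear_intro[of _ 1]) (auto simp: star_add star_scaleR norm_star)

text \<open>The root is \<open>1 - u\<close>, where \<open>u\<close> is the fixed point of the contraction \<open>u \<mapsto> (x + u\<^sup>2) / 2\<close>.\<close>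

lemma sqrt_one_minus:
  assumes x: "star x = x" "norm x < 1"
  obtains s where "star s = s" "s * s = 1 - x" "\<And>z. z * x = x * z \<Longrightarrow> z * s = s * z"
proof -
  define S where "S = {u. star u = u \<and> norm u \<le> norm x \<and> (\<forall>z. z * x = x * z \<longrightarrow> z * u = u * z)}"
  define f where "f u = (1/2) *\<^sub>R (x + u * u)" for u
  have cont: "continuous_on UNIV star"
    by (rule bounded_linear.continuous_on[OF bounded_linear_star continuous_on_id])
  have "closed S"
    unfolding S_def
    by (intro closed_Collect_conj closed_Collect_eq closed_Collect_le closed_Collect_all
        closed_Collect_imp open_Collect_const cont continuous_intros)
  then have "complete S"
    by (simp add: complete_eq_closed)
  moreover have "S \<noteq> {}"
    unfolding S_def by (auto intro!: exI[of _ 0] simp: star_zero)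
  moreover have "f ` S \<subseteq> S"
  proof (clarify)
    fix u assume u: "u \<in> S"
    have "norm (u * u) \<le> norm x * norm x"
      using u by (intro order_trans[OF norm_mult_ineq] mult_mono) (auto simp: S_def)
    also have "\<dots> \<le> 1 * norm x"
      using x by (intro mult_right_mono) auto
    finally have "norm (f u) \<le> norm x"
      using norm_triangle_ineq[of x "u * u"] by (simp add: f_def)
    moreover have "z * f u = f u * z" if "z * x = x * z" for z
    proof -
      have zu: "z * u = u * z" using u that by (auto simp: S_def)
      have "z * (u * u) = u * u * z"
        by (metis zu mult.assoc)
      then show ?thesis by (simp add: f_def that distrib_left distrib_right)
    qed
    moreover have "star (f u) = f u"
      using conjunct1[OF u[unfolded S_def mem_Collect_eq]] x by (simp add: f_def star_simps)
    ultimately show "f u \<in> S"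
      unfolding S_def by blast
  qed
  moreover have "\<forall>u\<in>S. \<forall>v\<in>S. dist (f u) (f v) \<le> norm x * dist u v"
  proof (intro ballI)
    fix u v assume uv: "u \<in> S" "v \<in> S"
    have "norm (u * u - v * v) = norm (u * (u - v) + (u - v) * v)"
      by (simp add: algebra_simps)
    also have "\<dots> \<le> norm u * norm (u - v) + norm (u - v) * norm v"
      by (intro order_trans[OF norm_triangle_ineq] add_mono norm_mult_ineq)
    also have "\<dots> \<le> norm x * norm (u - v) + norm (u - v) * norm x"
      using uv by (intro add_mono mult_mono) (auto simp: S_def)
    finally have *: "norm (u * u - v * v) \<le> 2 * (norm x * norm (u - v))"
      by (simp add: mult.commute)
    have "f u - f v = (1/2) *\<^sub>R (u * u - v * v)"
      by (simp add: f_def algebra_simps)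
    with * show "dist (f u) (f v) \<le> norm x * dist u v"
      by (simp add: dist_norm)
  qed
  ultimately obtain u where u: "u \<in> S" "f u = u"
    using Banach_fix[of S "norm x" f] x by (metis norm_ge_zero)
  have su: "star u = u" and comm: "\<And>z. z * x = x * z \<Longrightarrow> z * u = u * z"
    using u(1) unfolding S_def by blast+
  show thesis
  proof
    show "star (1 - u) = 1 - u"
      by (simp add: star_simps su)
    have "2 *\<^sub>R u = x + u * u"
      using arg_cong[OF u(2), of "\<lambda>v. 2 *\<^sub>R v"] by (simp add: f_def)
    then have "x = u + u - u * u" by (simp add: scaleR_2)
    then show "(1 - u) * (1 - u) = 1 - x"
      by (simp add: algebra_simps)
    show "z * (1 - u) = (1 - u) * z" if "z * x = x * z" for z
      by (simp add: right_diff_distrib left_diff_distrib comm[OF that])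
  qed
qed

text \<open>The element z = v + i w satisfies \<open>star z * z = 1\<close>, hence has norm 1, and v
  and v^2 - w^2 are the real parts of z and z^2.\<close>

lemma unitary_parts:
  assumes sa: "star v = v" "star w = w" and comm: "v * w = w * v" and one: "v * v + w * w = 1"
  shows "norm v \<le> 1" "norm (v * v - w * w) \<le> 1"
proof -
  define z where "z = v + scaleC \<i> w"
  have sz: "star z = v - scaleC \<i> w"
    by (simp add: z_def star_simps sa)
  have "star z * z = 1"
    unfolding sz using comm one
    by (simp add: z_def algebra_simps mult_scaleC_left mult_scaleC_right scaleC_i_i scaleC_diff_right)
  then have "(norm z)\<^sup>2 = 1"
    using cstar_identity[of z] by simp
  then have nz: "norm z = 1" using norm_ge_zero[of z] by (smt (verit) power2_eq_1_iff)
  have "2 *\<^sub>R v = z + star z"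
    unfolding sz by (simp add: z_def scaleR_2)
  then have "2 * norm v \<le> 2"
    using norm_triangle_ineq[of z "star z"] nz by (metis norm_scaleR norm_star abs_numeral one_add_one)
  then show "norm v \<le> 1" by simp
  have "2 *\<^sub>R (v * v - w * w) = z * z + star z * star z"
    unfolding sz by (simp add: z_def scaleR_2 algebra_simps mult_scaleC_left mult_scaleC_right scaleC_i_i
        scaleC_add_right scaleC_diff_right)
  then have "2 * norm (v * v - w * w) = norm (z * z + star z * star z)"
    by (metis norm_scaleR abs_numeral)
  also have "\<dots> \<le> norm z * norm z + norm (star z) * norm (star z)"
    by (intro order_trans[OF norm_triangle_ineq] add_mono norm_mult_ineq)
  finally show "norm (v * v - w * w) \<le> 1"
    by (simp add: norm_star nz)
qed

text \<open>Dividing by t > (norm s)^2 leaves y^2 = s^2 / t of norm below 1. The root r of 1 - y^2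
  commutes with y, so \<open>unitary_parts\<close> gives norm (1 - y^2) = (norm r)^2 \<le> 1, and t
  is a test point for \<open>numax\<close>.\<close>

lemma numax_neg_square:
  assumes s: "star s = s"
  shows "numax (- (s * s)) \<le> 0"
proof -
  define t where "t = (norm s)\<^sup>2 + 1"
  have t: "t > 0" by (simp add: t_def add_nonneg_pos)
  define c where "c = 1 / sqrt t"
  have cc: "c * c = 1 / t" using t by (simp add: c_def)
  define y where "y = c *\<^sub>R s"
  have y: "star y = y" "y * y = (1 / t) *\<^sub>R (s * s)"
    using s cc by (simp_all add: y_def star_simps)
  have "norm (y * y) < 1"
    using t norm_square_selfadjoint[OF s] by (simp add: y(2) t_def)
  then obtain r where r: "star r = r" "r * r = 1 - y * y" "\<And>z. z * (y * y) = (y * y) * z \<Longrightarrow> z * r = r * z"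
    using sqrt_one_minus[of "y * y"] y by (metis star_mult)
  have "norm r \<le> 1"
  proof (rule unitary_parts[of r y])
    show "r * y = y * r"
      by (rule r(3)[symmetric]) (simp only: mult.assoc)
  qed (use r(1,2) y(1) in simp_all)
  then have "norm (1 - y * y) \<le> 1"
    using norm_square_selfadjoint[OF r(1)] r(2) by (simp add: power_le_one)
  moreover have "t *\<^sub>R 1 - s * s = t *\<^sub>R (1 - y * y)"
    using t by (simp add: y(2) scaleR_diff_right)
  ultimately have "norm (t *\<^sub>R 1 - s * s) \<le> t"
    using t by simp
  then show ?thesis
    using numax_le[of t "- (s * s)"] t by simp
qed

text \<open>Strict negativity gives norm (t - k) < t, so k / t = 1 - x with norm x < 1. The root
  from \<open>sqrt_one_minus\<close> is then scaled by sqrt t.\<close>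

lemma sqrt_of_numax_neg:
  assumes k: "star k = k" "numax (- k) < 0"
  obtains w where "star w = w" "w * w = k" "\<And>z. z * k = k * z \<Longrightarrow> z * w = w * z"
proof -
  obtain t where t: "t \<ge> 0" "norm (t *\<^sub>R 1 - k) < t"
    using numax_lessE[OF k(2)] by auto
  then have t0: "t > 0" using norm_ge_zero[of "t *\<^sub>R 1 - k"] by linarith
  define x where "x = (1 / t) *\<^sub>R (t *\<^sub>R 1 - k)"
  have x: "star x = x" "norm x < 1" "1 - x = (1 / t) *\<^sub>R k"
  proof -
    show "star x = x" "1 - x = (1 / t) *\<^sub>R k"
      using t0 k by (simp_all add: x_def star_simps scaleR_diff_right)
    show "norm x < 1"
      using t t0 by (simp add: x_def)
  qed
  obtain s where s: "star s = s" "s * s = 1 - x" "\<And>z. z * x = x * z \<Longrightarrow> z * s = s * z"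
    using sqrt_one_minus[OF x(1,2)] by blast
  show thesis
  proof
    show "star (sqrt t *\<^sub>R s) = sqrt t *\<^sub>R s" by (simp add: star_simps s)
    show "(sqrt t *\<^sub>R s) * (sqrt t *\<^sub>R s) = k"
      using t0 by (simp add: s x)
    show "z * (sqrt t *\<^sub>R s) = (sqrt t *\<^sub>R s) * z" if "z * k = k * z" for z
      using s(3)[of z] that by (simp add: x_def left_diff_distrib right_diff_distrib)
  qed
qed

text \<open>For M slightly above m, both M + k and M - k have square roots. Scaled by 1 / sqrt (2 M)
  these commute, their squares sum to 1 and differ by k / M, so \<open>unitary_parts\<close>
  applies.\<close>

lemma norm_le_numax:
  assumes k: "star k = k" and le: "numax k \<le> m" "numax (- k) \<le> m"
  shows "norm k \<le> m"
proof (rule field_le_epsilon)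
  fix e :: real assume e: "e > 0"
  define M where "M = m + e"
  have M: "M > 0"
    using numax_minus[of k] le e by (simp add: M_def)
  have neg: "numax (- (M *\<^sub>R 1 + k)) < 0" "numax (- (M *\<^sub>R 1 - k)) < 0"
    using numax_diff_real[of "- k" M] numax_diff_real[of k M] le e
    by (simp_all add: M_def minus_diff_commute)
  have sa: "star (M *\<^sub>R 1 + k) = M *\<^sub>R 1 + k" "star (M *\<^sub>R 1 - k) = M *\<^sub>R 1 - k"
    by (simp_all add: star_simps k)
  obtain v where v: "star v = v" "v * v = M *\<^sub>R 1 + k"
    using sqrt_of_numax_neg[OF sa(1) neg(1)] by blast
  obtain w where w: "star w = w" "w * w = M *\<^sub>R 1 - k"
    "\<And>z. z * (M *\<^sub>R 1 - k) = (M *\<^sub>R 1 - k) * z \<Longrightarrow> z * w = w * z"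
    using sqrt_of_numax_neg[OF sa(2) neg(2)] by blast
  \<comment> \<open>The root v commutes with its square M + k, hence with M - k, hence with the root
    w.\<close>
  have "v * (v * v) = v * v * v" by (simp add: mult.assoc)
  then have "v * (M *\<^sub>R 1 - k) = (M *\<^sub>R 1 - k) * v"
    by (simp add: v(2) algebra_simps)
  then have comm: "v * w = w * v" by (rule w(3))
  define c where "c = 1 / sqrt (2 * M)"
  have cc: "c * c = 1 / (2 * M)" using M by (simp add: c_def)
  have 1: "(c *\<^sub>R v) * (c *\<^sub>R v) = (1 / (2 * M)) *\<^sub>R (M *\<^sub>R 1 + k)"
    "(c *\<^sub>R w) * (c *\<^sub>R w) = (1 / (2 * M)) *\<^sub>R (M *\<^sub>R 1 - k)"
    by (simp_all add: v(2) w(2) cc)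
  have 2: "(c *\<^sub>R v) * (c *\<^sub>R v) + (c *\<^sub>R w) * (c *\<^sub>R w) = 1"
    unfolding 1 scaleR_add_right[symmetric] using M by (simp add: scaleR_add_left[symmetric])
  have 3: "(c *\<^sub>R v) * (c *\<^sub>R v) - (c *\<^sub>R w) * (c *\<^sub>R w) = (1 / M) *\<^sub>R k"
    unfolding 1 scaleR_diff_right[symmetric] using M by (simp add: scaleR_2[symmetric])
  have "norm ((c *\<^sub>R v) * (c *\<^sub>R v) - (c *\<^sub>R w) * (c *\<^sub>R w)) \<le> 1"
    by (rule unitary_parts(2)[OF _ _ _ 2]) (simp_all add: star_simps v(1) w(1) comm)
  then show "norm k \<le> m + e"
    using M unfolding 3 by (simp add: field_simps M_def)
qed

text \<open>If \<open>p k - k\<close> were invertible, the inverse \<open>z\<close> of \<open>y = p k + e - k\<close> would stay bounded as \<open>e\<close> tends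
  to \<open>0\<close>, so that \<open>y - \<delta> = y (1 - \<delta> z)\<close> would be a square for some \<open>\<delta> > e\<close>. This
  forces \<open>p k \<le> p k + e - \<delta>\<close>.\<close>

lemma numax_in_spectrum:
  assumes k: "star k = k"
  shows "\<not> cinvertible (numax k *\<^sub>R 1 - k)"
proof
  define m where "m = numax k"
  define d where "d = m *\<^sub>R 1 - k"
  assume "cinvertible (numax k *\<^sub>R 1 - k)"
  then obtain z0 where z0: "z0 * d = 1"
    by (auto simp: cinvertible_def d_def m_def)
  define n where "n = norm z0 + 1"
  have n: "n > 0" by (simp add: n_def add_nonneg_pos)
  \<comment> \<open>Since e * norm z0 \<le> 1/4, the relation z = z0 - e z0 z gives norm z \<le> 4/3
    norm z0 < 2 n = 1 / \<delta>, while \<delta> = 2 e still exceeds e.\<close>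
  define e where "e = 1 / (4 * n)"
  define \<delta> where "\<delta> = 1 / (2 * n)"
  have e: "e > 0" "\<delta> > e" using n by (simp_all add: e_def \<delta>_def field_simps)
  define y where "y = d + e *\<^sub>R 1"
  have ny: "- y = k - (m + e) *\<^sub>R 1"
    by (simp add: y_def d_def algebra_simps)
  have neg: "numax (- y) < 0"
    unfolding ny numax_diff_real using e by (simp add: m_def)
  have sy: "star y = y"
    by (simp add: y_def d_def star_simps k)
  obtain z where z: "y * z = 1" "z * y = 1"
    using numax_neg_cinvertible[OF neg] by (auto simp: cinvertible_def)
  have "star z * y = 1"
    using arg_cong[OF z(1), of star] by (simp add: star_simps sy)
  then have "star z = z"
    using z(1) by (metis mult.assoc mult_1_left mult_1_right)
  have "z0 * y = 1 + e *\<^sub>R z0"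
    by (simp add: y_def distrib_left z0)
  then have "z0 * y * z = z + e *\<^sub>R (z0 * z)"
    by (simp add: distrib_right)
  then have "z = z0 - e *\<^sub>R (z0 * z)"
    by (simp add: mult.assoc z eq_diff_eq)
  then have "norm z \<le> norm z0 + norm (e *\<^sub>R (z0 * z))"
    using norm_triangle_ineq4[of z0 "e *\<^sub>R (z0 * z)"] by simp
  also have "norm (e *\<^sub>R (z0 * z)) \<le> e * (norm z0 * norm z)"
    using e norm_mult_ineq[of z0 z] by simp
  also have "e * (norm z0 * norm z) \<le> 1/4 * norm z"
  proof -
    have "e * norm z0 \<le> 1/4"
      using n by (simp add: e_def n_def field_simps)
    from mult_right_mono[OF this norm_ge_zero[of z]] show ?thesis by (simp add: mult.assoc)
  qed
  finally have "norm z \<le> norm z0 + 1/4 * norm z" by simp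
  then have "norm z < 2 * n"
    using norm_ge_zero[of z0] unfolding n_def by argo
  then have "norm (\<delta> *\<^sub>R z) < 1"
    using n by (simp add: \<delta>_def field_simps)
  moreover have "star (\<delta> *\<^sub>R z) = \<delta> *\<^sub>R z"
    by (simp add: star_simps \<open>star z = z\<close>)
  ultimately obtain r where r: "star r = r" "r * r = 1 - \<delta> *\<^sub>R z"
    "\<And>u. u * (\<delta> *\<^sub>R z) = (\<delta> *\<^sub>R z) * u \<Longrightarrow> u * r = r * u"
    using sqrt_one_minus[of "\<delta> *\<^sub>R z"] by blast
  obtain w where w: "star w = w" "w * w = y"
    using sqrt_of_numax_neg[OF sy neg] by blast
  \<comment> \<open>The root w commutes with y, so with its inverse z, so with the root r. This
    makes w r self-adjoint with square y (1 - \<delta> z).\<close>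
  have "w * y = y * w" by (simp add: mult.assoc flip: w(2))
  then have "w * z = z * w" by (rule inverse_commutes[OF z])
  then have wr: "w * r = r * w" by (intro r(3)) simp
  have "(w * r) * (w * r) = w * (r * w) * r" by (simp add: mult.assoc)
  also have "\<dots> = (w * w) * (r * r)" by (simp add: mult.assoc flip: wr)
  also have "\<dots> = y - \<delta> *\<^sub>R 1" by (simp add: w(2) r(2) right_diff_distrib z)
  finally have sq: "(w * r) * (w * r) = y - \<delta> *\<^sub>R 1" .
  have "star (w * r) = w * r" by (simp add: star_mult w(1) r(1) wr)
  from numax_neg_square[OF this] have "numax (- (y - \<delta> *\<^sub>R 1)) \<le> 0"
    unfolding sq .
  moreover have "- (y - \<delta> *\<^sub>R 1) = k - (m + e - \<delta>) *\<^sub>R 1"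
    using ny by (simp add: algebra_simps)
  ultimately show False
    using e numax_diff_real[of k "m + e - \<delta>"] by (simp add: m_def)
qed

section \<open>Positivity of \<open>star x * x\<close>\<close>

text \<open>Otherwise the left side is a positive spectral value of \<open>y * star y\<close> by
  \<open>numax_in_spectrum\<close>. Nonzero spectral values are shared with
  \<open>star y * y\<close>, whose \<open>numax\<close> is smaller.\<close>

lemma numax_mult_star_le:
  assumes "numax (star y * y) \<le> m" "m \<ge> 0"
  shows "numax (y * star y) \<le> m"
proof (rule ccontr)
  define t where "t = numax (y * star y)"
  assume "\<not> numax (y * star y) \<le> m"
  then have t: "t > m" by (simp add: t_def)
  have "numax (- (t *\<^sub>R 1 - star y * y)) < 0"
    using numax_diff_real[of "star y * y" t] assms t by simp
  from cinvertible_diff_mult_swap[OF numax_neg_cinvertible[OF this]] t assms(2)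
  have "cinvertible (t *\<^sub>R 1 - y * star y)" by simp
  moreover have "star (y * star y) = y * star y" by (simp add: star_simps)
  ultimately show False
    using numax_in_spectrum[of "y * star y"] by (simp add: t_def)
qed

text \<open>Twice the sum is a^2 + b^2 with a and b twice the real and, up to sign, the imaginary
  part of y; both squares are covered by \<open>numax_neg_square\<close>.\<close>

lemma numax_neg_star_mult_sum: "numax (- (star y * y + y * star y)) \<le> 0"
proof -
  define a where "a = y + star y"
  define b where "b = scaleC \<i> (y - star y)"
  have "star a = a" "star b = b"
    by (simp_all add: a_def b_def star_simps scaleC_diff_right add.commute)
  then have "numax (- (a * a)) + numax (- (b * b)) \<le> 0"
    using numax_neg_square[of a] numax_neg_square[of b] by simp
  then have "numax (- (a * a + b * b)) \<le> 0"
    using numax_add[of "- (a * a)" "- (b * b)"] by simp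
  also have "- (a * a + b * b) = 2 *\<^sub>R (- (star y * y + y * star y))"
    by (simp add: a_def b_def mult_scaleC_left mult_scaleC_right scaleC_i_i algebra_simps scaleR_2
        scaleC_add_right scaleC_diff_right)
  finally show ?thesis
    using numax_scale[of 2 "- (star y * y + y * star y)"] by simp
qed

text \<open>Otherwise \<open>-1\<close> is in the spectrum of \<open>h = x\<^sup>* x\<close>. For \<open>y = x (1 - h)\<close> we have
  \<open>y\<^sup>* y = h (1 - h)\<^sup>2\<close>, which is at most \<open>1\<close> but has \<open>-4\<close> in its spectrum; yet \<open>y y\<^sup>* \<le> 1\<close>
  and \<open>y\<^sup>* y + y y\<^sup>* \<ge> 0\<close> give \<open>y\<^sup>* y \<ge> -1\<close>.\<close>

lemma numax_star_mult_one:
  assumes x: "norm x = 1"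
  shows "numax (star x * x) \<ge> 1"
proof (rule ccontr)
  define h where "h = star x * x"
  assume "\<not> 1 \<le> numax (star x * x)"
  then have h1: "numax h < 1" by (simp add: h_def)
  have sh: "star h = h" by (simp add: h_def star_simps)
  have nh: "norm h = 1" by (simp add: h_def cstar_identity x)
  \<comment> \<open>By \<open>norm_le_numax\<close> one of \<open>numax h\<close> and
    \<open>numax (- h)\<close> reaches norm h = 1, and the first does not.\<close>
  have "numax (- h) \<ge> 1"
    using norm_le_numax[OF sh, of "max (numax h) (numax (- h))"] h1 nh by auto
  then have "numax (- h) = 1"
    using numax_le_norm[of "- h"] nh by simp
  then have ninv: "\<not> cinvertible (1 + h)"
    using numax_in_spectrum[of "- h"] by (simp add: star_simps sh)
  define u where "u = 1 - h"
  have "numax (- u) < 0"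
    using numax_diff_real[of h 1] h1 by (simp add: u_def)
  moreover have su: "star u = u" by (simp add: u_def star_simps sh)
  ultimately obtain v where v: "star v = v" "v * v = u"
    using sqrt_of_numax_neg[of u] by blast
  define y where "y = x * u"
  have yy: "star y * y = u * h * u"
    by (simp add: y_def star_simps su h_def mult.assoc)
  \<comment> \<open>As v^2 = u, the identity 1 - u (1 - u) u = u (1 - u)^2 + (1 - u)^2 + u writes 1
    - \<open>star y * y\<close> as a sum of three squares, the first being a^2.\<close>
  define a where "a = v * (u - 1)"
  have hu: "h = 1 - u" by (simp add: u_def)
  have vu: "u * v = v * u" by (simp add: mult.assoc flip: v(2))
  have sq: "a * a + (1 - u) * (1 - u) + v * v = 1 - star y * y"
    unfolding yy a_def hu by (simp add: v(2)[symmetric] algebra_simps)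
  have "star a = a"
    by (simp add: a_def star_simps v(1) su algebra_simps vu)
  then have "numax (- (a * a)) \<le> 0" "numax (- ((1 - u) * (1 - u))) \<le> 0" "numax (- (v * v)) \<le> 0"
    by (intro numax_neg_square; simp add: star_simps su v(1))+
  then have "numax (- (a * a + (1 - u) * (1 - u) + v * v)) \<le> 0"
    using numax_add[of "- (a * a)" "- ((1 - u) * (1 - u))"]
      numax_add[of "- (a * a) - (1 - u) * (1 - u)" "- (v * v)"] by simp
  then have "numax (star y * y) \<le> 1"
    unfolding sq using numax_diff_real[of "star y * y" 1] by simp
  then have "numax (y * star y) \<le> 1"
    by (rule numax_mult_star_le) simp
  then have "numax (- (star y * y)) \<le> 1"
    using numax_neg_star_mult_sum[of y] numax_add[of "- (star y * y + y * star y)" "y * star y"]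
    by simp
  then have "numax (- (4 *\<^sub>R 1 + star y * y)) < 0"
    using numax_diff_real[of "- (star y * y)" 4] by (simp add: minus_diff_commute)
  then have "cinvertible (4 *\<^sub>R 1 + star y * y)"
    by (rule numax_neg_cinvertible)
  moreover have "4 *\<^sub>R h = h + h + h + h"
    using scaleR_add_left[of 2 2 h] by (simp add: scaleR_2 add.assoc)
  \<comment> \<open>The polynomial s (1 - s)^2 + 4 vanishes at s = -1; dividing by 1 + s leaves s^2
    - 3 s + 4.\<close>
  then have "4 *\<^sub>R 1 + star y * y = (1 + h) * (h * h - h - h - h + 4 *\<^sub>R 1)"
    "(1 + h) * (h * h - h - h - h + 4 *\<^sub>R 1) = (h * h - h - h - h + 4 *\<^sub>R 1) * (1 + h)"
    unfolding yy u_def by (simp_all add: algebra_simps)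
  ultimately show False
    using cinvertible_commuting_factor ninv by metis
qed

lemma numax_star_mult: "numax (star x * x) = (norm x)\<^sup>2"
proof (rule antisym)
  show "numax (star x * x) \<le> (norm x)\<^sup>2"
    using numax_le_norm[of "star x * x"] by (simp add: cstar_identity)
  show "(norm x)\<^sup>2 \<le> numax (star x * x)"
  proof (cases "x = 0")
    case False
    define y where "y = (1 / norm x) *\<^sub>R x"
    have "norm y = 1" using False by (simp add: y_def)
    have "star x * x = (norm x)\<^sup>2 *\<^sub>R (star y * y)"
      using False by (simp add: y_def star_simps power2_eq_square)
    then have "numax (star x * x) = (norm x)\<^sup>2 * numax (star y * y)"
      by (simp add: numax_scale)
    then show ?thesis
      using numax_star_mult_one[OF \<open>norm y = 1\<close>] by (simp add: mult_le_cancel_left1)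
  qed (simp add: numax_zero)
qed

text \<open>The square of norm (t + i h) is at most t^2 + (norm h)^2, so the test value at t is of
  order 1 / t. The chosen t has 2 t e = (norm h)^2, which bounds the test value by e.\<close>

lemma numax_scaleC_i:
  assumes h: "star h = h"
  shows "numax (scaleC \<i> h) \<le> 0"
proof (rule field_le_epsilon)
  fix e :: real assume e: "e > 0"
  define t where "t = (norm h)\<^sup>2 / (2 * e)"
  have t: "t \<ge> 0" using e by (simp add: t_def)
  let ?y = "t *\<^sub>R 1 + scaleC \<i> h"
  have "(norm ?y)\<^sup>2 = norm (star ?y * ?y)" by (simp add: cstar_identity)
  also have "star ?y * ?y = (t * t) *\<^sub>R 1 + h * h"
    by (simp add: star_simps h algebra_simps mult_scaleC_left mult_scaleC_right scaleC_i_i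
        scaleC_diff_right scaleC_add_right scaleC_scaleR)
  also have "norm \<dots> \<le> t * t + (norm h)\<^sup>2"
    using norm_triangle_ineq[of "(t * t) *\<^sub>R 1" "h * h"] norm_square_selfadjoint[OF h] by simp
  also have "\<dots> \<le> (t + e)\<^sup>2"
    using e by (simp add: t_def power2_eq_square field_simps)
  finally have "norm ?y \<le> t + e"
    using t e by (auto dest: power2_le_imp_le)
  then show "numax (scaleC \<i> h) \<le> 0 + e"
    using numax_le[OF t, of "scaleC \<i> h"] by simp
qed

end

subsection \<open>States\<close>

lemma dist_to_best:
  assumes "b0 \<in> B" "\<forall>b\<in>B. norm (a - b0) \<le> norm (a - b)"
  shows "dist_to a B = norm (a - b0)"
  unfolding dist_to_def by (rule cInf_eq_minimum) (use assms in auto)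

context cstar_algebra
begin

section \<open>Spectral positivity compared with \<open>numax\<close>\<close>

lemma cinvertible_scaleC:
  assumes "cinvertible x" "c \<noteq> 0"
  shows "cinvertible (scaleC c x)"
proof -
  obtain y where "x * y = 1" "y * x = 1" using assms by (auto simp: cinvertible_def)
  then show ?thesis
    using assms(2)
    by (auto simp: cinvertible_def mult_scaleC_left mult_scaleC_right scaleC_scaleC scaleC_one
        intro!: exI[of _ "scaleC (1 / c) y"])
qed

lemma cspectrum_cmod_le:
  assumes "z \<in> cspectrum scaleC x"
  shows "cmod z \<le> norm x"
proof (rule ccontr)
  assume "\<not> cmod z \<le> norm x"
  then have less: "norm x < cmod z" by simp
  then have z: "z \<noteq> 0" using norm_ge_zero[of x] by force
  have "norm (scaleC (1 / z) x) < 1"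
    using less z by (simp add: norm_scaleC norm_divide)
  from cinvertible_scaleC[OF cinvertible_one_minus[OF this], of "- z"] z
  have "cinvertible (x - scaleC z 1)"
    by (simp add: scaleC_diff_right scaleC_scaleC scaleC_minus_left scaleC_one)
  then show False using assms by (simp add: cspectrum_def)
qed

text \<open>Shifting by i t keeps the squared norm below (norm h)^2 + t^2, whereas (Im z + t)^2
  gains the cross term 2 t Im z. The chosen t makes this term (norm h)^2 + 1.\<close>

lemma cspectrum_selfadjoint_real:
  assumes h: "star h = h" and z: "z \<in> cspectrum scaleC h"
  shows "Im z = 0"
proof (rule ccontr)
  assume nz: "Im z \<noteq> 0"
  define t where "t = ((norm h)\<^sup>2 + 1) / (2 * Im z)"
  define c where "c = \<i> * complex_of_real t"
  define y where "y = h + scaleC c 1"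
  have cc: "cnj c * c = complex_of_real (t * t)"
    by (simp add: c_def complex_eq_iff)
  have "y - scaleC (z + c) 1 = h - scaleC z 1"
    by (simp add: y_def scaleC_add_left)
  then have "z + c \<in> cspectrum scaleC y"
    using z by (simp add: cspectrum_def)
  then have "(cmod (z + c))\<^sup>2 \<le> (norm y)\<^sup>2"
    by (intro power_mono cspectrum_cmod_le) auto
  also have "(norm y)\<^sup>2 = norm (star y * y)" by (simp add: cstar_identity)
  also have "star y * y = h * h + (t * t) *\<^sub>R 1"
  proof -
    have "star y * y = h * h + scaleC c h + scaleC (cnj c) h + scaleC (cnj c * c) 1"
      by (simp add: y_def star_simps star_scaleC h algebra_simps mult_scaleC_left mult_scaleC_right
          scaleC_scaleC scaleC_add_right)
    also have "scaleC (cnj c) h = - scaleC c h"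
      by (simp add: c_def flip: scaleC_minus_left)
    finally show ?thesis by (simp only: cc scaleC_of_real) simp
  qed
  also have "norm \<dots> \<le> (norm h)\<^sup>2 + t * t"
    using norm_triangle_ineq[of "h * h" "(t * t) *\<^sub>R 1"] norm_square_selfadjoint[OF h] by simp
  finally have "(Re z)\<^sup>2 + (Im z + t)\<^sup>2 \<le> (norm h)\<^sup>2 + t * t"
    by (simp add: cmod_power2 c_def)
  moreover have "2 * Im z * t = (norm h)\<^sup>2 + 1"
    using nz by (simp add: t_def)
  moreover have "(Im z + t)\<^sup>2 = (Im z)\<^sup>2 + 2 * Im z * t + t * t"
    by (simp add: power2_eq_square algebra_simps)
  ultimately show False
    using zero_le_power2[of "Re z"] zero_le_power2[of "Im z"] by linarith
qed

text \<open>Reflection z \<mapsto> r - z carries the spectrum of r - h into that of h, which lies in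
  the disc of radius r. These elements make states real and bounded on self-adjoint
  elements.\<close>

lemma positive_elem_norm_diff:
  assumes h: "star h = h" and r: "norm h \<le> r"
  shows "positive_elem scaleC star (r *\<^sub>R 1 - h)"
  unfolding positive_elem_def
proof (intro conjI subsetI)
  show sa: "star (r *\<^sub>R 1 - h) = r *\<^sub>R 1 - h"
    by (simp add: star_simps h)
  fix z assume z: "z \<in> cspectrum scaleC (r *\<^sub>R 1 - h)"
  have "complex_of_real r - z \<in> cspectrum scaleC h"
  proof (rule ccontr)
    assume "complex_of_real r - z \<notin> cspectrum scaleC h"
    then have "cinvertible (h - scaleC (complex_of_real r + - z) 1)"
      by (simp add: cspectrum_def)
    from cinvertible_scaleR[OF this, of "-1"] have "cinvertible (r *\<^sub>R 1 - h - scaleC z 1)"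
      by (simp add: scaleC_add_left scaleC_of_real scaleC_minus_left del: add_uminus_conv_diff)
         (simp add: algebra_simps)
    then show False using z by (simp add: cspectrum_def)
  qed
  then have "cmod (complex_of_real r - z) \<le> r"
    using cspectrum_cmod_le r by (meson order_trans)
  then have "Re z \<ge> 0"
    using complex_Re_le_cmod[of "complex_of_real r - z"] by simp
  then show "z \<in> {z. Im z = 0 \<and> 0 \<le> Re z}"
    using cspectrum_selfadjoint_real[OF sa z] by simp
qed

text \<open>The number - numax (- h) is a spectral value of h by \<open>numax_in_spectrum\<close>.
  This links positivity in \<open>is_state\<close> to functionals dominated by
  \<open>numax\<close>.\<close>

lemma positive_elem_numax:
  assumes "positive_elem scaleC star h"
  shows "numax (- h) \<le> 0"
proof -
  define m where "m = numax (- h)"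
  have h: "star h = h" and spec: "cspectrum scaleC h \<subseteq> {z. Im z = 0 \<and> Re z \<ge> 0}"
    using assms by (auto simp: positive_elem_def)
  have "\<not> cinvertible (m *\<^sub>R 1 + h)"
    using numax_in_spectrum[of "- h"] by (simp add: star_simps h m_def)
  moreover have "h - scaleC (complex_of_real (- m)) 1 = m *\<^sub>R 1 + h"
    unfolding scaleC_of_real by simp
  ultimately have "complex_of_real (- m) \<in> cspectrum scaleC h"
    by (simp only: cspectrum_def mem_Collect_eq not_False_eq_True)
  with spec have "0 \<le> Re (complex_of_real (- m))" by blast
  then show ?thesis by (simp add: m_def)
qed

section \<open>Consequences of positivity for a fixed state, and bounds on
  \<open>M_aB\<close>\<close>

context
  fixes \<phi> assumes \<phi>: "is_state scaleC star \<phi>"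
begin

lemma state_add: "\<phi> (x + y) = \<phi> x + \<phi> y"
  and state_scaleC: "\<phi> (scaleC c x) = c * \<phi> x"
  and state_one: "\<phi> 1 = 1"
  and state_positive: "positive_elem scaleC star x \<Longrightarrow> Im (\<phi> x) = 0 \<and> Re (\<phi> x) \<ge> 0"
  using \<phi> by (auto simp: is_state_def)

lemma state_scaleR: "\<phi> (r *\<^sub>R x) = complex_of_real r * \<phi> x"
  using state_scaleC[of "complex_of_real r" x] by (simp add: scaleC_of_real)

lemma state_diff: "\<phi> (x - y) = \<phi> x - \<phi> y"
  using state_add[of x "- y"] state_scaleR[of "-1" y] by simp

lemma state_selfadjoint:
  assumes h: "star h = h"
  shows "Im (\<phi> h) = 0" "Re (\<phi> h) \<le> norm h"
  using state_positive[OF positive_elem_norm_diff[OF h order_refl]]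
  by (simp_all add: state_diff state_scaleR state_one)

text \<open>A state is real on x + \<open>star x\<close>, which compares imaginary parts, and on i
  (x - \<open>star x\<close>), which compares real parts.\<close>

lemma state_star: "\<phi> (star x) = cnj (\<phi> x)"
proof -
  have "Im (\<phi> (x + star x)) = 0"
    by (rule state_selfadjoint) (simp add: star_simps add.commute)
  moreover have "Im (\<phi> (scaleC \<i> (x - star x))) = 0"
    by (rule state_selfadjoint) (simp add: star_simps scaleC_diff_right)
  ultimately show ?thesis
    by (simp add: state_add state_scaleC state_diff complex_eq_iff)
qed

lemma state_star_mult_le: "Re (\<phi> (star x * x)) \<le> (norm x)\<^sup>2"
  using state_selfadjoint(2)[of "star x * x"] by (simp add: star_simps cstar_identity)

text \<open>Zorn's lemma on orthonormal sets of representatives. It ensures that the supremum in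
  \<open>M_aB\<close> runs over a nonempty set.\<close>

lemma quot_onb_exists: "\<exists>S. quot_onb star \<phi> B S"
proof -
  define \<A> where "\<A> = {S. S \<subseteq> B \<and> (\<forall>x\<in>S. \<phi> (star x * x) = 1) \<and>
     (\<forall>x\<in>S. \<forall>y\<in>S. x \<noteq> y \<longrightarrow> \<phi> (star x * y) = 0)}"
  have "\<exists>M\<in>\<A>. \<forall>X\<in>\<A>. M \<subseteq> X \<longrightarrow> X = M"
  proof (rule subset_Zorn')
    fix \<C> assume \<C>: "subset.chain \<A> \<C>"
    then have sub: "\<C> \<subseteq> \<A>" and chain: "\<And>X Y. X \<in> \<C> \<Longrightarrow> Y \<in> \<C> \<Longrightarrow> X \<subseteq> Y \<or> Y \<subseteq> X"
      by (auto simp: subset_chain_def)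
    have orth: "\<phi> (star x * y) = 0" if xy: "X \<in> \<C>" "x \<in> X" "Y \<in> \<C>" "y \<in> Y" "x \<noteq> y" for X Y x y
    proof -
      obtain Z where "Z \<in> \<C>" "x \<in> Z" "y \<in> Z"
        using chain[OF xy(1,3)] xy by blast
      then show ?thesis using sub xy(5) by (auto simp: \<A>_def)
    qed
    show "\<Union>\<C> \<in> \<A>"
      unfolding \<A>_def
    proof (intro CollectI conjI ballI impI)
      show "\<Union>\<C> \<subseteq> B"
        using sub by (auto simp: \<A>_def)
      show "\<phi> (star x * x) = 1" if "x \<in> \<Union>\<C>" for x
        using sub that by (auto simp: \<A>_def)
      show "\<phi> (star x * y) = 0" if "x \<in> \<Union>\<C>" "y \<in> \<Union>\<C>" "x \<noteq> y" for x y
        using orth that by blast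
    qed
  qed
  then obtain M where M: "M \<in> \<A>" and max: "\<And>X. X \<in> \<A> \<Longrightarrow> M \<subseteq> X \<Longrightarrow> X = M" by blast
  have max_onb: False if b: "b \<in> B" "\<phi> (star b * b) = 1" "\<forall>x\<in>M. \<phi> (star x * b) = 0" for b
  proof -
    have "b \<notin> M" using b by auto
    \<comment> \<open>Maximality in \<open>quot_onb\<close> speaks of b as second argument only;
      Hermitian symmetry supplies the other order, so that b can be adjoined to M.\<close>
    have "\<phi> (star b * x) = 0" if "x \<in> M" for x
      using state_star[of "star x * b"] b(3) that by (simp add: star_simps)
    then have "insert b M \<in> \<A>"
      using M b by (auto simp: \<A>_def)
    then show False using max[of "insert b M"] \<open>b \<notin> M\<close> by blast
  qed
  have "quot_onb star \<phi> B M"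
    unfolding quot_onb_def
    by (intro conjI notI) (use M max_onb in \<open>auto simp: \<A>_def\<close>)
  then show ?thesis by blast
qed

lemma M_aB_le: "M_aB star a B b0 \<phi> \<le> (norm (a - b0))\<^sup>2"
  unfolding M_aB_def
proof (rule cSup_least)
  show "{Re (\<phi> (star (a - b0) * (a - b0)))
      - (\<Sum>\<^sub>\<infinity>x\<in>S. (cmod (\<phi> (star (a - b0) * x)))\<^sup>2) |S. quot_onb star \<phi> B S} \<noteq> {}"
    using quot_onb_exists by blast
next
  fix v assume "v \<in> {Re (\<phi> (star (a - b0) * (a - b0)))
      - (\<Sum>\<^sub>\<infinity>x\<in>S. (cmod (\<phi> (star (a - b0) * x)))\<^sup>2) |S. quot_onb star \<phi> B S}"
  then obtain S where v: "v = Re (\<phi> (star (a - b0) * (a - b0)))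
      - (\<Sum>\<^sub>\<infinity>x\<in>S. (cmod (\<phi> (star (a - b0) * x)))\<^sup>2)" by blast
  \<comment> \<open>This also covers a family that is not summable, whose sum is 0 by
    default.\<close>
  have "(\<Sum>\<^sub>\<infinity>x\<in>S. (cmod (\<phi> (star (a - b0) * x)))\<^sup>2) \<ge> 0"
    by (rule infsum_nonneg) simp
  then show "v \<le> (norm (a - b0))\<^sup>2"
    using state_star_mult_le[of "a - b0"] by (simp add: v)
qed

lemma M_aB_orthogonal:
  assumes orth: "\<And>b. b \<in> B \<Longrightarrow> \<phi> (star (a - b0) * b) = 0"
  shows "M_aB star a B b0 \<phi> = Re (\<phi> (star (a - b0) * (a - b0)))"
proof -
  have "(\<Sum>\<^sub>\<infinity>x\<in>S. (cmod (\<phi> (star (a - b0) * x)))\<^sup>2) = 0" if "quot_onb star \<phi> B S" for S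
    by (rule infsum_0) (use that orth in \<open>auto simp: quot_onb_def\<close>)
  then have "{Re (\<phi> (star (a - b0) * (a - b0)))
      - (\<Sum>\<^sub>\<infinity>x\<in>S. (cmod (\<phi> (star (a - b0) * x)))\<^sup>2) |S. quot_onb star \<phi> B S}
    = {Re (\<phi> (star (a - b0) * (a - b0)))}"
    using quot_onb_exists by force
  then show ?thesis by (simp add: M_aB_def)
qed

end

section \<open>Construction of the extremal state\<close>

text \<open>Domination at h and - h turns \<open>numax_scaleC_i\<close> into g (i h) = 0 for
  self-adjoint h, and at 1 and - 1 it pins g 1 = 1. Positivity is
  \<open>positive_elem_numax\<close>.\<close>

lemma state_of_numax_dominated:
  assumes lin: "linear g" and le: "\<And>x. g x \<le> numax x"
  defines "\<phi> \<equiv> \<lambda>x. Complex (g x) (- g (scaleC \<i> x))"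
  shows "is_state scaleC star \<phi>"
  unfolding is_state_def
proof (intro conjI allI impI)
  have imag: "g (scaleC \<i> h) = 0" if "star h = h" for h
  proof (rule antisym)
    show "g (scaleC \<i> h) \<le> 0"
      using le numax_scaleC_i[OF that] by (rule order_trans)
    have "g (scaleC \<i> (- h)) \<le> 0"
      by (rule order_trans[OF le numax_scaleC_i]) (simp add: star_simps that)
    then show "0 \<le> g (scaleC \<i> h)"
      by (simp add: scaleC_minus_right linear_neg[OF lin])
  qed
  show "\<phi> (x + y) = \<phi> x + \<phi> y" for x y
    by (simp add: \<phi>_def scaleC_add_right linear_add[OF lin] complex_eq_iff)
  show "\<phi> (scaleC c x) = c * \<phi> x" for c x
  proof -
    have c: "scaleC c y = Re c *\<^sub>R y + Im c *\<^sub>R scaleC \<i> y" for y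
      using scaleC_add_left[of "complex_of_real (Re c)" "complex_of_real (Im c) * \<i>" y]
      by (simp add: scaleC_of_real complex_eq[of c, symmetric] mult.commute scaleC_scaleR
          flip: scaleC_scaleC)
    show ?thesis
      unfolding \<phi>_def c
      by (simp add: complex_eq_iff scaleC_add_right scaleC_scaleR scaleC_i_i linear_add[OF lin]
          linear_diff[OF lin] linear_scale[OF lin])
  qed
  show "\<phi> 1 = 1"
  proof -
    have "g 1 \<le> 1" "g (- 1) \<le> - 1"
      using le[of 1] le[of "- 1"] numax_of_real[of 1, where 'a='a]
        numax_of_real[of "-1", where 'a='a] by simp_all
    then show ?thesis
      using imag[OF star_one] by (simp add: \<phi>_def complex_eq_iff linear_neg[OF lin])
  qed
  fix c assume c: "positive_elem scaleC star c"
  then show "Im (\<phi> c) = 0"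
    using imag[of c] by (simp add: \<phi>_def positive_elem_def)
  show "0 \<le> Re (\<phi> c)"
    using le[of "- c"] positive_elem_numax[OF c] by (simp add: \<phi>_def linear_neg[OF lin])
qed

text \<open>First-order variation: for y = c + (t / 2) b, sublinearity bounds the
  \<open>numax\<close> of \<open>star y * y\<close> by (1 - t) N + t numax w + O(t^2). It is at
  least N, and dividing by t gives the claim up to e.\<close>

lemma numax_orthogonal:
  assumes "\<And>t. norm c \<le> norm (c + t *\<^sub>R b)"
  shows "(norm c)\<^sup>2 \<le> numax (star c * c + star c * b)"
proof (rule field_le_epsilon)
  define N where "N = (norm c)\<^sup>2"
  define w where "w = star c * c + star c * b"
  fix e :: real assume e: "e > 0"
  \<comment> \<open>The bound 1 keeps the weight 1 - t nonnegative, as \<open>numax_scale\<close>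
    requires; the other bound keeps the remainder t (norm b)^2 / 4 below e.\<close>
  define t where "t = min 1 (e / ((norm b)\<^sup>2 + 1))"
  have b1: "(norm b)\<^sup>2 + 1 > 0" by (simp add: add_nonneg_pos)
  have t: "0 < t" "t \<le> 1" "t * (norm b)\<^sup>2 \<le> e"
  proof -
    show t: "0 < t" "t \<le> 1" using e b1 by (simp_all add: t_def)
    then have "t * (norm b)\<^sup>2 \<le> t * ((norm b)\<^sup>2 + 1)" by simp
    also have "\<dots> \<le> e / ((norm b)\<^sup>2 + 1) * ((norm b)\<^sup>2 + 1)"
      using b1 by (intro mult_right_mono) (auto simp: t_def)
    also have "\<dots> = e" using b1 by simp
    finally show "t * (norm b)\<^sup>2 \<le> e" .
  qed
  define y where "y = c + (t / 2) *\<^sub>R b"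
  have "N \<le> (norm y)\<^sup>2"
    unfolding N_def y_def by (intro power_mono assms) auto
  also have "\<dots> = numax (star y * y)" by (simp add: numax_star_mult)
  also have "star y * y = (1 - t) *\<^sub>R (star c * c) + (t / 2) *\<^sub>R (w + star w)
      + (t * t / 4) *\<^sub>R (star b * b)"
  proof -
    have "star y * y = star c * c + (t / 2) *\<^sub>R (star c * b + star b * c) + (t * t / 4) *\<^sub>R (star b * b)"
      by (simp add: y_def star_simps algebra_simps)
    moreover have "(1 - t) *\<^sub>R (star c * c) + (t / 2) *\<^sub>R (w + star w)
        = star c * c + (t / 2) *\<^sub>R (star c * b + star b * c)"
      using scaleR_add_left[of "t / 2" "t / 2" "star c * c"]
      by (simp add: w_def star_simps algebra_simps)
    ultimately show ?thesis by simp
  qed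
  also have "numax \<dots> \<le> (1 - t) * N + t * numax w + t * t / 4 * (norm b)\<^sup>2"
  proof -
    have "numax (w + star w) \<le> 2 * numax w"
      using numax_add[of w "star w"] by (simp add: numax_star)
    then have "numax ((t / 2) *\<^sub>R (w + star w)) \<le> t * numax w"
      using t mult_left_mono[of "numax (w + star w)" "2 * numax w" "t / 2"] by (simp add: numax_scale)
    moreover have "numax ((1 - t) *\<^sub>R (star c * c)) = (1 - t) * N"
      using t by (simp add: numax_scale numax_star_mult N_def)
    moreover have "numax ((t * t / 4) *\<^sub>R (star b * b)) = t * t / 4 * (norm b)\<^sup>2"
      using t by (simp add: numax_scale numax_star_mult)
    ultimately show ?thesis
      using numax_add[of "(1 - t) *\<^sub>R (star c * c)" "(t / 2) *\<^sub>R (w + star w)"]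
        numax_add[of "(1 - t) *\<^sub>R (star c * c) + (t / 2) *\<^sub>R (w + star w)" "(t * t / 4) *\<^sub>R (star b * b)"]
      by simp
  qed
  finally have "t * N \<le> t * (numax w + t * (norm b)\<^sup>2 / 4)"
    by (simp add: algebra_simps)
  then have "N \<le> numax w + t * (norm b)\<^sup>2 / 4"
    using t(1) by simp
  then show "(norm c)\<^sup>2 \<le> numax (star c * c + star c * b) + e"
    using t(3) e unfolding N_def w_def by linarith
qed

lemma orthogonal_state_exists:
  assumes B: "complex_subspace scaleC B"
    and orth: "\<And>b. b \<in> B \<Longrightarrow> norm c \<le> norm (c + b)"
  obtains \<phi> where "is_state scaleC star \<phi>" "Re (\<phi> (star c * c)) = (norm c)\<^sup>2"
    "\<And>b. b \<in> B \<Longrightarrow> \<phi> (star c * b) = 0"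
proof -
  have B0: "0 \<in> B" and Badd: "\<And>x y. x \<in> B \<Longrightarrow> y \<in> B \<Longrightarrow> x + y \<in> B"
    and BC: "\<And>k x. x \<in> B \<Longrightarrow> scaleC k x \<in> B"
    using B by (auto simp: complex_subspace_def)
  have BR: "r *\<^sub>R x \<in> B" if "x \<in> B" for r x
    using BC[OF that, of "complex_of_real r"] by (simp add: scaleC_of_real)
  define N where "N = (norm c)\<^sup>2"
  have N: "N \<le> numax (star c * c + star c * b)" if "b \<in> B" for b
    unfolding N_def by (rule numax_orthogonal) (simp add: orth BR that)
  \<comment> \<open>The cone encodes the demands g (\<open>star c * c\<close>) \<ge> N and g
    (\<open>star c * b\<close>) \<ge> 0 for b in \<open>B\<close>.\<close>
  define C where "C = {(t *\<^sub>R (star c * c) + star c * b, t * N) | t b. t \<ge> 0 \<and> b \<in> B}"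
  have CI: "(t *\<^sub>R (star c * c) + star c * b, t * N) \<in> C" if "t \<ge> 0" "b \<in> B" for t b
    using that by (auto simp: C_def)
  have CE: "\<exists>t b. z = (t *\<^sub>R (star c * c) + star c * b, t * N) \<and> t \<ge> 0 \<and> b \<in> B" if "z \<in> C" for z
    using that by (auto simp: C_def)
  have cone: "convex_cone C"
    unfolding convex_cone_iff
  proof (intro conjI ballI allI impI)
    show "0 \<in> C" using CI[of 0 0] B0 by (simp add: zero_prod_def)
  next
    fix z z' assume "z \<in> C" "z' \<in> C"
    then obtain t b t' b' where z: "z = (t *\<^sub>R (star c * c) + star c * b, t * N)" "t \<ge> 0" "b \<in> B"
      and z': "z' = (t' *\<^sub>R (star c * c) + star c * b', t' * N)" "t' \<ge> 0" "b' \<in> B"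
      using CE by meson
    then show "z + z' \<in> C"
      using CI[of "t + t'" "b + b'"] Badd by (simp add: algebra_simps)
  next
    fix z and r :: real assume "z \<in> C" and r: "r \<ge> 0"
    then obtain t b where z: "z = (t *\<^sub>R (star c * c) + star c * b, t * N)" "t \<ge> 0" "b \<in> B"
      using CE by meson
    then show "r *\<^sub>R z \<in> C"
      using CI[of "r * t" "r *\<^sub>R b"] BR r by (simp add: scaleR_add_right mult.assoc)
  qed
  have "t * N \<le> numax (t *\<^sub>R (star c * c) + star c * b)" if t: "t \<ge> 0" and b: "b \<in> B" for t b
  proof (cases "t = 0")
    \<comment> \<open>Here the claim is 0 \<le> numax (\<open>star c * b\<close>), which follows by
      cancelling N = numax (\<open>star c * c\<close>) in the bound for t = 1.\<close>
    case True
    then show ?thesis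
      using numax_add[of "star c * c" "star c * b"] N[OF b] by (simp add: numax_star_mult N_def)
  next
    case False
    then have "t *\<^sub>R (star c * c) + star c * b = t *\<^sub>R (star c * c + star c * ((1 / t) *\<^sub>R b))"
      by (simp add: scaleR_add_right)
    then have "numax (t *\<^sub>R (star c * c) + star c * b) = t * numax (star c * c + star c * ((1 / t) *\<^sub>R b))"
      by (simp only: numax_scale[OF t])
    then show ?thesis
      using N[OF BR[OF b, of "1 / t"]] t by (simp add: mult_left_mono)
  qed
  then have dom: "\<forall>(x, r)\<in>C. r \<le> numax x"
    by (auto simp: C_def)
  obtain g where g: "linear g" "\<And>x. g x \<le> numax x" "\<And>x r. (x, r) \<in> C \<Longrightarrow> r \<le> g x"
    using Hahn_Banach_cone[OF sublinear_numax cone dom] by blast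
  have cc: "g (star c * c) = N"
    using g(2)[of "star c * c"] g(3)[OF CI[of 1 0]] B0
    by (simp add: numax_star_mult N_def)
  \<comment> \<open>Both b and - b lie in \<open>B\<close>, which turns the inequality into an
    equality.\<close>
  have g0: "g (star c * b) = 0" if "b \<in> B" for b
    using g(3)[OF CI[of 0 b]] g(3)[OF CI[of 0 "(- 1) *\<^sub>R b"]] that BR[OF that, of "-1"]
    by (simp add: linear_neg[OF g(1)])
  show thesis
  proof
    let ?\<phi> = "\<lambda>x. Complex (g x) (- g (scaleC \<i> x))"
    show "is_state scaleC star ?\<phi>"
      by (rule state_of_numax_dominated[OF g(1,2)])
    show "Re (?\<phi> (star c * c)) = (norm c)\<^sup>2"
      by (simp add: cc N_def)
    show "?\<phi> (star c * b) = 0" if "b \<in> B" for b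
      \<comment> \<open>The imaginary part is - g (\<open>star c * scaleC \<i> b\<close>), and
        \<open>B\<close> is closed under multiplication by i.\<close>
      using g0[OF that] g0[OF BC[OF that, of \<i>]] by (simp add: complex_eq_iff mult_scaleC_right)
  qed
qed

end

theorem theorem4p5:
  fixes scaleC :: "complex \<Rightarrow> 'a::{real_normed_algebra_1,banach} \<Rightarrow> 'a"
    and star :: "'a \<Rightarrow> 'a"
    and a b0 :: 'a
    and B :: "'a set"
  assumes "cstar_algebra scaleC star"
    and "complex_subspace scaleC B"
    and "b0 \<in> B"
    and "\<forall>b\<in>B. norm (a - b0) \<le> norm (a - b)"
  shows "(\<exists>\<phi>\<in>states scaleC star. M_aB star a B b0 \<phi> = (dist_to a B)\<^sup>2) \<and>
         (\<forall>\<phi>\<in>states scaleC star. M_aB star a B b0 \<phi> \<le> (dist_to a B)\<^sup>2)"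
proof -
  interpret cstar_algebra scaleC star by fact
  have dist: "dist_to a B = norm (a - b0)"
    by (rule dist_to_best[OF assms(3,4)])
  \<comment> \<open>Best approximation becomes Birkhoff-James orthogonality of a - b0 to
    \<open>B\<close>, by comparing b0 with b0 - b.\<close>
  have "norm (a - b0) \<le> norm (a - b0 + b)" if "b \<in> B" for b
  proof -
    have "b0 + scaleC (-1) b \<in> B"
      using assms(2,3) that by (simp add: complex_subspace_def)
    then have "b0 - b \<in> B"
      by (simp add: scaleC_minus_left scaleC_one)
    with assms(4) have "norm (a - b0) \<le> norm (a - (b0 - b))" by blast
    then show ?thesis by (simp add: algebra_simps)
  qed
  then obtain \<phi> where \<phi>: "is_state scaleC star \<phi>"
    "Re (\<phi> (star (a - b0) * (a - b0))) = (norm (a - b0))\<^sup>2"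
    "\<And>b. b \<in> B \<Longrightarrow> \<phi> (star (a - b0) * b) = 0"
    using orthogonal_state_exists[OF assms(2), of "a - b0"] by blast
  have "M_aB star a B b0 \<phi> = (dist_to a B)\<^sup>2"
    using M_aB_orthogonal[OF \<phi>(1,3)] \<phi>(2) dist by simp
  then show ?thesis
    using \<phi>(1) M_aB_le dist by (auto simp: states_def)
qed

end
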